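(* For all positive integers $n\ne 1,3$, the graph $(K_n\,\Box\,K_2)\circ\overline{K}_2$ has pretty good state transfer between the vertices of $\overline{K}_2$; that is, writing $1,2$ for the vertices of $\overline{K}_2$, for each vertex $v$ of $K_n\,\Box\,K_2$ there is pretty good state transfer between $(v,1)$ and $(v,2)$.
   Context: $K_n$ is the complete graph on $n$ vertices, $\overline{K}_2$ is the edgeless graph on $2$ vertices, and $\Box$ is the Cartesian product of graphs, so $A(K_n\,\Box\,K_2)=A(K_n)\otimes I_2+I_n\otimes A(K_2)$. The corona $G\circ H$ of graphs $G,H$ has vertex set $V(G)\times(\{0\}\cup V(H))$ (where $0\notin V(H)$), and $(v,w)$ is adjacent to $(v',w')$ iff one of the following holds: $w=w'=0$ and $v,v'$ are adjacent in $G$; or $v=v'$ and $w,w'\in V(H)$ are adjacent in $H$; or $v=v'$ and exactly one of $w,w'$ equals $0$. A graph $X$ with adjacency matrix $A(X)$ has pretty good state transfer between vertices $a,b$ if for every $\epsilon>0$ there are a time $\tau$ and a complex number $\gamma$ with $|\gamma|=1$ such that $\|e^{-\mathrm{i}\tau A(X)}e_a-\gamma e_b\|<\epsilon$, where $e_a$ is the standard basis vector indexed by $a$. *)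

theory Defs
  imports "HOL-Analysis.Analysis" "Graph_Theory.Graph_Theory"
begin

text \<open>
  A finite simple graph is a symmetric, loop-free, finite digraph without parallel arcs,
  that is, a \<^verbatim>\<open>pair_graph\<close> of the AFP entry \<^verbatim>\<open>Graph_Theory\<close>. An undirected edge is represented by
  its two orientations.
\<close>

definition complete_graph :: "nat \<Rightarrow> nat pair_pre_digraph" where
  "complete_graph n = \<lparr> pverts = {1..n}, parcs = {(u, v). u \<in> {1..n} \<and> v \<in> {1..n} \<and> u \<noteq> v} \<rparr>"

definition edgeless_graph :: "nat \<Rightarrow> nat pair_pre_digraph" where
  "edgeless_graph n = \<lparr> pverts = {1..n}, parcs = {} \<rparr>"

definition cartesian_product ::
  "'a pair_pre_digraph \<Rightarrow> 'b pair_pre_digraph \<Rightarrow> ('a \<times> 'b) pair_pre_digraph" (infixl "\<box>" 70) where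
  "G \<box> H = \<lparr>
     pverts = pverts G \<times> pverts H,
     parcs = {((u, x), (v, y)).
       ((u, v) \<in> parcs G \<and> x = y \<and> x \<in> pverts H) \<or> (u = v \<and> u \<in> pverts G \<and> (x, y) \<in> parcs H)} \<rparr>"

text \<open>
  In the corona, \<^verbatim>\<open>None\<close> plays the role of the extra symbol \<open>0 \<notin> V(H)\<close>, and a vertex
  \<open>w\<close> of \<open>H\<close> appears as \<^verbatim>\<open>Some w\<close>.
\<close>

definition corona ::
  "'a pair_pre_digraph \<Rightarrow> 'b pair_pre_digraph \<Rightarrow> ('a \<times> 'b option) pair_pre_digraph" where
  "corona G H = \<lparr>
     pverts = pverts G \<times> ({None} \<union> Some ` pverts H),
     parcs = {((v, w), (v', w')).
       v \<in> pverts G \<and> v' \<in> pverts G \<and>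
       w \<in> {None} \<union> Some ` pverts H \<and> w' \<in> {None} \<union> Some ` pverts H \<and>
       ((w = None \<and> w' = None \<and> (v, v') \<in> parcs G) \<or>
        (v = v' \<and> (\<exists>x y. w = Some x \<and> w' = Some y \<and> (x, y) \<in> parcs H)) \<or>
        (v = v' \<and> (w = None) \<noteq> (w' = None)))} \<rparr>"

text \<open>
  Matrices and vectors indexed by a finite set \<open>V\<close> are functions whose values outside \<open>V\<close>
  are never used: all sums, and the Euclidean norm, range over \<open>V\<close>.
\<close>

definition adj_matrix :: "'a pair_pre_digraph \<Rightarrow> 'a \<Rightarrow> 'a \<Rightarrow> complex" where
  "adj_matrix X u v = of_bool ((u, v) \<in> parcs X)"

definition mmul :: "'a set \<Rightarrow> ('a \<Rightarrow> 'a \<Rightarrow> complex) \<Rightarrow> ('a \<Rightarrow> 'a \<Rightarrow> complex) \<Rightarrow> 'a \<Rightarrow> 'a \<Rightarrow> complex" where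
  "mmul V M N u v = (\<Sum>w\<in>V. M u w * N w v)"

definition mvec :: "'a set \<Rightarrow> ('a \<Rightarrow> 'a \<Rightarrow> complex) \<Rightarrow> ('a \<Rightarrow> complex) \<Rightarrow> 'a \<Rightarrow> complex" where
  "mvec V M x u = (\<Sum>v\<in>V. M u v * x v)"

definition unit_vec :: "'a \<Rightarrow> 'a \<Rightarrow> complex" where
  "unit_vec a u = of_bool (u = a)"

definition vnorm :: "'a set \<Rightarrow> ('a \<Rightarrow> complex) \<Rightarrow> real" where
  "vnorm V x = L2_set (\<lambda>u. cmod (x u)) V"

primrec mpow :: "'a set \<Rightarrow> ('a \<Rightarrow> 'a \<Rightarrow> complex) \<Rightarrow> nat \<Rightarrow> 'a \<Rightarrow> 'a \<Rightarrow> complex" where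
  "mpow V M 0 = (\<lambda>u v. of_bool (u = v))"
| "mpow V M (Suc k) = mmul V M (mpow V M k)"

text \<open>The entries of the exponential series converge absolutely, see \<open>summable_mexp\<close> below.\<close>

definition mexp :: "'a set \<Rightarrow> ('a \<Rightarrow> 'a \<Rightarrow> complex) \<Rightarrow> 'a \<Rightarrow> 'a \<Rightarrow> complex" where
  "mexp V M u v = (\<Sum>k. mpow V M k u v / fact k)"

definition transition_matrix :: "'a pair_pre_digraph \<Rightarrow> real \<Rightarrow> 'a \<Rightarrow> 'a \<Rightarrow> complex" where
  "transition_matrix X \<tau> = mexp (pverts X) (\<lambda>u v. - \<i> * of_real \<tau> * adj_matrix X u v)"

definition pretty_good_state_transfer :: "'a pair_pre_digraph \<Rightarrow> 'a \<Rightarrow> 'a \<Rightarrow> bool" where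
  "pretty_good_state_transfer X a b \<longleftrightarrow>
     a \<in> pverts X \<and> b \<in> pverts X \<and>
     (\<forall>\<epsilon>>0. \<exists>(\<tau>::real) (\<gamma>::complex). cmod \<gamma> = 1 \<and>
        vnorm (pverts X)
          (\<lambda>u. mvec (pverts X) (transition_matrix X \<tau>) (unit_vec a) u - \<gamma> * unit_vec b u) < \<epsilon>)"


lemma complete_graph_complete_digraph: "complete_digraph n (with_proj (complete_graph n))"
  by (auto simp: complete_digraph_pair_def complete_graph_def)

lemma pair_graph_complete_graph: "pair_graph (complete_graph n)"
  by (rule pair_graphI_complete[OF complete_graph_complete_digraph])

lemma pair_graph_edgeless_graph: "pair_graph (edgeless_graph n)"
  by unfold_locales (auto simp: edgeless_graph_def symmetric_def sym_def)

lemma pair_graph_cartesian_product: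
  assumes "pair_graph G" "pair_graph H"
  shows "pair_graph (G \<box> H)"
proof -
  interpret G: pair_graph G by fact
  interpret H: pair_graph H by fact
  have sub: "parcs (G \<box> H) \<subseteq> (pverts G \<times> pverts H) \<times> (pverts G \<times> pverts H)"
    by (auto simp: cartesian_product_def dest: G.wellformed' H.wellformed')
  have fin: "finite (parcs (G \<box> H))"
    by (rule finite_subset[OF sub]) (auto intro: G.pair_finite_verts H.pair_finite_verts)
  have symG: "(u, v) \<in> parcs G \<Longrightarrow> (v, u) \<in> parcs G" for u v
    using G.pair_sym_arcs by (auto simp: symmetric_def sym_def)
  have symH: "(u, v) \<in> parcs H \<Longrightarrow> (v, u) \<in> parcs H" for u v
    using H.pair_sym_arcs by (auto simp: symmetric_def sym_def)
  show ?thesis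
  proof unfold_locales
    show "symmetric (with_proj (G \<box> H))"
      unfolding symmetric_def with_proj_simps
      by (rule symI) (auto simp: cartesian_product_def dest: symG symH)
  next
    show "finite (pverts (G \<box> H))"
      by (simp add: cartesian_product_def G.pair_finite_verts H.pair_finite_verts)
  next
    fix e assume e: "e \<in> parcs (G \<box> H)"
    then show "fst e \<in> pverts (G \<box> H)" "snd e \<in> pverts (G \<box> H)"
      using subsetD[OF sub e] by (auto simp: cartesian_product_def)
    show "fst e \<noteq> snd e"
      using e by (auto simp: cartesian_product_def dest: G.pair_no_loops H.pair_no_loops)
  qed (rule fin)
qed

lemma pair_graph_corona:
  assumes "pair_graph G" "pair_graph H"
  shows "pair_graph (corona G H)"
proof -
  interpret G: pair_graph G by fact
  interpret H: pair_graph H by fact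
  let ?V = "pverts G \<times> ({None} \<union> Some ` pverts H)"
  have sub: "parcs (corona G H) \<subseteq> ?V \<times> ?V"
    unfolding corona_def by auto
  have fin: "finite (parcs (corona G H))"
    by (rule finite_subset[OF sub]) (auto intro: G.pair_finite_verts H.pair_finite_verts)
  have symG: "(u, v) \<in> parcs G \<Longrightarrow> (v, u) \<in> parcs G" for u v
    using G.pair_sym_arcs by (auto simp: symmetric_def sym_def)
  have symH: "(u, v) \<in> parcs H \<Longrightarrow> (v, u) \<in> parcs H" for u v
    using H.pair_sym_arcs by (auto simp: symmetric_def sym_def)
  show ?thesis
  proof unfold_locales
    show "symmetric (with_proj (corona G H))"
      unfolding symmetric_def with_proj_simps
      by (rule symI) (auto simp: corona_def dest: symG symH)
  next
    show "finite (pverts (corona G H))"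
      by (simp add: corona_def G.pair_finite_verts H.pair_finite_verts)
  next
    fix e assume e: "e \<in> parcs (corona G H)"
    then show "fst e \<in> pverts (corona G H)" "snd e \<in> pverts (corona G H)"
      using subsetD[OF sub e] by (auto simp: corona_def)
    show "fst e \<noteq> snd e"
      using e by (auto simp: corona_def dest: G.pair_no_loops H.pair_no_loops)
  qed (rule fin)
qed

lemma adj_matrix_cartesian_product:
  assumes "pair_graph G" "pair_graph H"
    and "u \<in> pverts G" "v \<in> pverts G" "x \<in> pverts H" "y \<in> pverts H"
  shows "adj_matrix (G \<box> H) (u, x) (v, y) =
    adj_matrix G u v * of_bool (x = y) + of_bool (u = v) * adj_matrix H x y"
proof -
  interpret G: pair_graph G by fact
  interpret H: pair_graph H by fact
  show ?thesis
    using assms(3-) G.pair_no_loops[of "(u, u)"] H.pair_no_loops[of "(x, x)"]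
    by (auto simp: adj_matrix_def cartesian_product_def)
qed

lemma summable_mexp:
  assumes "finite V" "u \<in> V" "v \<in> V"
  shows "summable (\<lambda>k. norm (mpow V M k u v / fact k))"
proof -
  define C where "C = (\<Sum>u\<in>V. \<Sum>w\<in>V. cmod (M u w))"
  have row: "(\<Sum>w\<in>V. cmod (M u w)) \<le> C" if "u \<in> V" for u
    unfolding C_def using that assms(1) by (intro member_le_sum) (auto intro: sum_nonneg)
  have C0: "C \<ge> 0"
    unfolding C_def by (intro sum_nonneg) auto
  have bound: "cmod (mpow V M k u v) \<le> C ^ k" if "u \<in> V" for k u
    using that
  proof (induction k arbitrary: u)
    case (Suc k)
    have "cmod (mpow V M (Suc k) u v) \<le> (\<Sum>w\<in>V. cmod (M u w) * cmod (mpow V M k w v))"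
      by (auto simp: mmul_def norm_mult intro!: sum_norm_le)
    also have "\<dots> \<le> (\<Sum>w\<in>V. cmod (M u w) * C ^ k)"
      by (intro sum_mono mult_left_mono Suc.IH) auto
    also have "\<dots> = (\<Sum>w\<in>V. cmod (M u w)) * C ^ k"
      by (simp add: sum_distrib_right)
    also have "\<dots> \<le> C * C ^ k"
      using row[OF Suc.prems] C0 by (intro mult_right_mono) auto
    finally show ?case by simp
  qed auto
  have "summable (\<lambda>k. C ^ k / fact k)"
    using summable_exp[of C] by (simp add: field_simps)
  then show ?thesis
    by (rule summable_comparison_test[rotated])
      (use bound[OF assms(2)] in \<open>auto simp: norm_divide intro!: divide_right_mono\<close>)
qed

end

theory Submission
  imports Defs "HOL-Computational_Algebra.Squarefree"
begin

text \<open>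
  Let \<open>G\<close> be a graph whose adjacency eigenvalues \<open>l\<close> are integers. Over an eigenvector \<open>y\<close> of \<open>G\<close>
  with eigenvalue \<open>l\<close>, the corona of \<open>G\<close> with two isolated vertices has two eigenvectors, equal to
  \<open>y\<close> on both layers of leaves and to \<open>\<mu> y\<close> on \<open>G\<close>, where \<open>\<mu>\<close> runs over the roots
  \<open>(l \<plusminus> sqrt (l\<^sup>2 + 8)) / 2\<close> of \<open>\<mu>\<^sup>2 = l \<mu> + 2\<close>. The remaining eigenvectors are antisymmetric in
  the two leaves and have eigenvalue \<open>0\<close>. The unit vector at the leaf \<open>(v, 1)\<close> is half the symmetric
  plus half the antisymmetric vector at \<open>v\<close>; the one at \<open>(v, 2)\<close> is half the symmetric minus half the
  antisymmetric vector. Hence \<open>(v, 1)\<close> is sent close to \<open>-(v, 2)\<close> at every time \<open>\<tau>\<close> for which all the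
  phases \<open>exp (- \<i> \<tau> \<mu>)\<close> with \<open>\<mu>\<close> as above are close to \<open>- 1\<close>. For \<open>\<tau> = 4 \<pi> m\<close> with an integer \<open>m\<close>
  this says that every \<open>m sqrt (l\<^sup>2 + 8)\<close> is close to \<open>1/2\<close> modulo \<open>1\<close>.

  Such an \<open>m\<close> is supplied by Kronecker's approximation theorem. Square roots of distinct squarefree
  numbers are linearly independent over the rationals (\<open>sqrt_squarefree_independent\<close>), so the
  fractional parts of \<open>m sqrt d\<close> for finitely many squarefree \<open>d > 1\<close> can be prescribed
  independently. Write \<open>l\<^sup>2 + 8 = d b\<^sup>2\<close> with \<open>d\<close> squarefree. Several \<open>l\<close> may share the same \<open>d\<close>, but
  working modulo \<open>8\<close> shows that \<open>b\<close> is odd if \<open>d\<close> is \<open>1\<close> modulo \<open>8\<close> and that \<open>b\<close> is \<open>2\<close> modulo \<open>4\<close>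
  otherwise; therefore the targets \<open>1/2\<close> and \<open>1/4\<close> for \<open>m sqrt d\<close>, respectively, serve all of them
  simultaneously (\<open>sqrt_square_plus_8_approx_half\<close>). The case \<open>d = 1\<close>, which would break the
  argument, occurs only for \<open>l = 1\<close> and \<open>l = - 1\<close>.

  The eigenvalues of the Cartesian product of \<open>K\<^sub>n\<close> and \<open>K\<^sub>2\<close> are \<open>n\<close>, \<open>n - 2\<close>, \<open>0\<close> and \<open>- 2\<close>, and none of
  them is \<open>1\<close> or \<open>- 1\<close> when \<open>n \<noteq> 1\<close> and \<open>n \<noteq> 3\<close>.
\<close>

section \<open>Linear independence of square roots\<close>

lemma sqrt_nat_irrational:
  fixes p m :: nat
  assumes "prime p" "\<not> p dvd m"
  shows "sqrt (real (p * m)) \<notin> \<rat>"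
proof
  assume "sqrt (real (p * m)) \<in> \<rat>"
  then obtain a b :: nat where b: "b \<noteq> 0" and ab: "\<bar>sqrt (real (p * m))\<bar> = real a / real b"
    by (elim Rats_abs_nat_div_natE)
  have m0: "m \<noteq> 0" and p0: "p \<noteq> 0" using assms by (auto intro: Nat.gr0I)
  have "real (p * m) = (real a / real b)\<^sup>2"
    by (simp flip: ab)
  then have "real (p * m * b\<^sup>2) = real (a\<^sup>2)"
    using b by (simp add: field_simps)
  then have eq: "p * m * b\<^sup>2 = a\<^sup>2"
    by (simp only: of_nat_eq_iff)
  with m0 p0 b have a: "a \<noteq> 0" by (auto intro: Nat.gr0I)
  have "multiplicity p (p * m * b\<^sup>2) = Suc (2 * multiplicity p b)"
    using assms m0 p0 b
    by (simp add: prime_elem_multiplicity_mult_distrib prime_elem_multiplicity_power_distrib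
        not_dvd_imp_multiplicity_0)
  moreover have "multiplicity p (a\<^sup>2) = 2 * multiplicity p a"
    using assms a by (simp add: prime_elem_multiplicity_power_distrib)
  ultimately have "Suc (2 * multiplicity p b) = 2 * multiplicity p a"
    using eq by metis
  then show False by presburger
qed

text \<open>
  The subfield of the reals generated by the square roots of a list of natural numbers. Adjoining
  \<open>sqrt p\<close> to a field amounts to forming all \<open>a + b sqrt p\<close>, whether or not \<open>sqrt p\<close> is already in
  the field.
\<close>

primrec sqrt_field :: "nat list \<Rightarrow> real set" where
  "sqrt_field [] = \<rat>"
| "sqrt_field (p # ps) = {a + b * sqrt (real p) | a b. a \<in> sqrt_field ps \<and> b \<in> sqrt_field ps}"

lemma sqrt_field_ConsI:
  "a \<in> sqrt_field ps \<Longrightarrow> b \<in> sqrt_field ps \<Longrightarrow> a + b * sqrt (real p) \<in> sqrt_field (p # ps)"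
  by auto

lemma Rats_subset_sqrt_field: "x \<in> \<rat> \<Longrightarrow> x \<in> sqrt_field ps"
proof (induction ps arbitrary: x)
  case (Cons p ps)
  then show ?case
    using sqrt_field_ConsI[of x ps 0 p] by simp
qed simp

lemma sqrt_field_subset_Cons: "x \<in> sqrt_field ps \<Longrightarrow> x \<in> sqrt_field (p # ps)"
  using sqrt_field_ConsI[of x ps 0 p] Rats_subset_sqrt_field[of 0] by simp

lemma sqrt_field_add: "x \<in> sqrt_field ps \<Longrightarrow> y \<in> sqrt_field ps \<Longrightarrow> x + y \<in> sqrt_field ps"
proof (induction ps arbitrary: x y)
  case (Cons p ps)
  then obtain a b c d where
    "x = a + b * sqrt (real p)" "y = c + d * sqrt (real p)"
    "a \<in> sqrt_field ps" "b \<in> sqrt_field ps" "c \<in> sqrt_field ps" "d \<in> sqrt_field ps"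
    by auto
  then show ?case
    using sqrt_field_ConsI[OF Cons.IH[of a c] Cons.IH[of b d]] by (simp add: algebra_simps)
qed simp

lemma sqrt_field_mult: "x \<in> sqrt_field ps \<Longrightarrow> y \<in> sqrt_field ps \<Longrightarrow> x * y \<in> sqrt_field ps"
proof (induction ps arbitrary: x y)
  case (Cons p ps)
  then obtain a b c d where
    xy: "x = a + b * sqrt (real p)" "y = c + d * sqrt (real p)" and
    mem: "a \<in> sqrt_field ps" "b \<in> sqrt_field ps" "c \<in> sqrt_field ps" "d \<in> sqrt_field ps"
    by auto
  have "real p \<in> sqrt_field ps"
    by (simp add: Rats_subset_sqrt_field)
  then have "(a * c + (b * d) * real p) + (a * d + b * c) * sqrt (real p) \<in> sqrt_field (p # ps)"
    using mem by (intro sqrt_field_ConsI sqrt_field_add Cons.IH)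
  also have "(a * c + (b * d) * real p) + (a * d + b * c) * sqrt (real p) = x * y"
    unfolding xy by (simp add: algebra_simps flip: power2_eq_square)
  finally show ?case .
qed simp

lemma sqrt_field_minus: "x \<in> sqrt_field ps \<Longrightarrow> - x \<in> sqrt_field ps"
  using sqrt_field_mult[of "-1" ps x] by (simp add: Rats_subset_sqrt_field)

lemma sqrt_field_inverse: "x \<in> sqrt_field ps \<Longrightarrow> inverse x \<in> sqrt_field ps"
proof (induction ps arbitrary: x)
  case (Cons p ps)
  then obtain a b where x: "x = a + b * sqrt (real p)" "a \<in> sqrt_field ps" "b \<in> sqrt_field ps"
    by auto
  \<comment> \<open>The denominator is rationalised with the conjugate, unless the conjugate vanishes.\<close>
  show ?case
  proof (cases "a = b * sqrt (real p)")
    case True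
    then have "inverse x = inverse (2 * a)"
      using x by simp
    moreover have "2 * a \<in> sqrt_field ps"
      using x by (intro sqrt_field_mult) (simp_all add: Rats_subset_sqrt_field)
    ultimately show ?thesis
      using Cons.IH sqrt_field_subset_Cons by metis
  next
    case False
    define n where "n = a * a + - (b * b * real p)"
    have n: "n = x * (a - b * sqrt (real p))"
      unfolding n_def x by (simp add: algebra_simps flip: power2_eq_square)
    have "n \<in> sqrt_field ps"
      unfolding n_def using x
      by (intro sqrt_field_add sqrt_field_minus sqrt_field_mult) (simp_all add: Rats_subset_sqrt_field)
    then have "a * inverse n + (- b * inverse n) * sqrt (real p) \<in> sqrt_field (p # ps)"
      using x by (intro sqrt_field_ConsI sqrt_field_mult sqrt_field_minus Cons.IH)
    also have "a * inverse n + (- b * inverse n) * sqrt (real p) = (a - b * sqrt (real p)) * inverse n"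
      by (simp add: algebra_simps)
    also have "\<dots> = inverse x"
      unfolding n using False by (simp add: inverse_mult_distrib)
    finally show ?thesis .
  qed
qed simp

lemma sqrt_field_divide: "x \<in> sqrt_field ps \<Longrightarrow> y \<in> sqrt_field ps \<Longrightarrow> x / y \<in> sqrt_field ps"
  by (simp add: divide_inverse sqrt_field_mult sqrt_field_inverse)

lemma sqrt_field_sum: "(\<And>i. i \<in> I \<Longrightarrow> f i \<in> sqrt_field ps) \<Longrightarrow> sum f I \<in> sqrt_field ps"
  by (induction I rule: infinite_finite_induct)
    (auto intro: sqrt_field_add simp: Rats_subset_sqrt_field)

lemma sqrt_prod_in_sqrt_field:
  "S \<subseteq> set ps \<Longrightarrow> distinct ps \<Longrightarrow> sqrt (real (\<Prod>S)) \<in> sqrt_field ps"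
proof (induction ps arbitrary: S)
  case (Cons p ps)
  show ?case
  proof (cases "p \<in> S")
    case True
    then have S: "S = insert p (S - {p})" by auto
    have "sqrt (real (\<Prod>S)) = 0 + sqrt (real (\<Prod>(S - {p}))) * sqrt (real p)"
      using Cons.prems True finite_subset[OF Cons.prems(1)]
      by (subst S, subst prod.insert) (auto simp: real_sqrt_mult)
    also have "\<dots> \<in> sqrt_field (p # ps)"
      using Cons.prems by (intro sqrt_field_ConsI Cons.IH) (auto simp: Rats_subset_sqrt_field)
    finally show ?thesis .
  next
    case False
    then show ?thesis
      using Cons by (intro sqrt_field_subset_Cons Cons.IH) auto
  qed
qed simp

text \<open>
  The step of the induction: if \<open>sqrt m = a + b sqrt p\<close> with \<open>a\<close> and \<open>b\<close> in a field, squaring shows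
  that one of \<open>sqrt p\<close>, \<open>sqrt m\<close>, \<open>sqrt (m p)\<close> lies in that field.
\<close>

lemma sqrt_in_sqrt_field_imp:
  assumes "sqrt (real m) \<in> sqrt_field ps" "distinct ps"
  shows "\<exists>S \<subseteq> set ps. sqrt (real (m * \<Prod>S)) \<in> \<rat>"
  using assms
proof (induction ps arbitrary: m)
  case Nil
  then show ?case by auto
next
  case (Cons p ps)
  then obtain a b where
    m: "sqrt (real m) = a + b * sqrt (real p)" and ab: "a \<in> sqrt_field ps" "b \<in> sqrt_field ps"
    by auto
  have *: ?case if "sqrt (real m) \<in> sqrt_field ps"
    using Cons.IH[OF that] Cons.prems by auto
  consider "b = 0" | "a = 0" | "a \<noteq> 0" "b \<noteq> 0" by blast
  then show ?case
  proof cases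
    case 1
    then show ?thesis using * m ab by simp
  next
    case 2
    then have "sqrt (real (m * p)) = b * real p"
      using m by (simp add: real_sqrt_mult flip: power2_eq_square)
    also have "\<dots> \<in> sqrt_field ps"
      using ab by (intro sqrt_field_mult) (simp_all add: Rats_subset_sqrt_field)
    finally have "sqrt (real (m * p)) \<in> sqrt_field ps" .
    then obtain S where S: "S \<subseteq> set ps" "sqrt (real (m * p * \<Prod>S)) \<in> \<rat>"
      using Cons.IH[of "m * p"] Cons.prems(2) by (auto simp del: of_nat_mult)
    have "m * p * \<Prod>S = m * \<Prod>(insert p S)"
      using Cons.prems S finite_subset[OF S(1)] by (subst prod.insert) auto
    with S show ?thesis
      by (intro exI[of _ "insert p S"]) auto
  next
    case 3
    have "real m = (a + b * sqrt (real p))\<^sup>2"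
      by (simp flip: m)
    then have "sqrt (real p) = (real m + - (a * a + b * b * real p)) / (2 * a * b)"
      using 3 by (simp add: field_simps power2_eq_square)
    also have "\<dots> \<in> sqrt_field ps"
      using ab by (intro sqrt_field_divide sqrt_field_add sqrt_field_minus sqrt_field_mult)
        (simp_all add: Rats_subset_sqrt_field)
    finally have "sqrt (real m) \<in> sqrt_field ps"
      unfolding m using ab by (intro sqrt_field_add sqrt_field_mult)
    then show ?thesis by (rule *)
  qed
qed

text \<open>
  A relation over the primes \<open>p, ps\<close> has the form \<open>A + B sqrt p = 0\<close> with \<open>A\<close> and \<open>B\<close> in the field
  generated by the square roots of \<open>ps\<close>. That field does not contain \<open>sqrt p\<close>, so \<open>A\<close> and \<open>B\<close>
  vanish, and both are relations over \<open>ps\<close>.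
\<close>

lemma sqrt_prod_primes_independent:
  assumes "distinct ps" "\<And>p. p \<in> set ps \<Longrightarrow> prime p"
    and "\<And>S. c S \<in> \<rat>"
    and "(\<Sum>S\<in>Pow (set ps). c S * sqrt (real (\<Prod>S))) = 0"
    and "S \<subseteq> set ps"
  shows "c S = 0"
  using assms
proof (induction ps arbitrary: c S)
  case Nil
  then show ?case by simp
next
  case (Cons p ps)
  let ?P = "Pow (set ps)"
  define A where "A = (\<Sum>S\<in>?P. c S * sqrt (real (\<Prod>S)))"
  define B where "B = (\<Sum>S\<in>?P. c (insert p S) * sqrt (real (\<Prod>S)))"
  have p: "p \<notin> set ps" "distinct ps" "prime p"
    using Cons.prems by auto
  have prod_p: "\<Prod>(insert p T) = p * \<Prod>T" if "T \<subseteq> set ps" for T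
    using that p finite_subset[OF that] by (subst prod.insert) auto
  have "0 = (\<Sum>S\<in>?P \<union> insert p ` ?P. c S * sqrt (real (\<Prod>S)))"
    using Cons.prems(4) by (simp add: Pow_insert)
  also have "\<dots> = A + (\<Sum>S\<in>insert p ` ?P. c S * sqrt (real (\<Prod>S)))"
    unfolding A_def using p by (intro sum.union_disjoint) auto
  also have "(\<Sum>S\<in>insert p ` ?P. c S * sqrt (real (\<Prod>S))) =
      (\<Sum>S\<in>?P. c (insert p S) * sqrt (real (\<Prod>(insert p S))))"
    using p by (subst sum.reindex) (auto simp: inj_on_def insert_ident subset_iff)
  also have "\<dots> = B * sqrt (real p)"
    unfolding B_def sum_distrib_right
    by (intro sum.cong refl) (simp add: prod_p real_sqrt_mult)
  finally have AB: "A + B * sqrt (real p) = 0" by simp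
  have mem: "A \<in> sqrt_field ps" "B \<in> sqrt_field ps"
    unfolding A_def B_def using Cons.prems(3) p
    by (intro sqrt_field_sum sqrt_field_mult sqrt_prod_in_sqrt_field; simp add: Rats_subset_sqrt_field)+
  have "B = 0"
  proof (rule ccontr)
    assume "B \<noteq> 0"
    then have "sqrt (real p) = - A / B"
      using AB by (simp add: field_simps)
    also have "\<dots> \<in> sqrt_field ps"
      using mem by (intro sqrt_field_divide sqrt_field_minus)
    finally obtain T where T: "T \<subseteq> set ps" "sqrt (real (p * \<Prod>T)) \<in> \<rat>"
      using sqrt_in_sqrt_field_imp p by blast
    have "\<not> p dvd \<Prod>T"
    proof
      assume "p dvd \<Prod>T"
      then obtain q where "q \<in> T" "p dvd q"
        using p T finite_subset[OF T(1)] by (auto simp: prime_dvd_prod_iff)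
      with T Cons.prems(2) p show False
        by (metis in_mono list.set_intros(2) primes_dvd_imp_eq)
    qed
    with T sqrt_nat_irrational p show False by blast
  qed
  with AB have "A = 0" by simp
  have "c T = 0" if "T \<subseteq> set ps" for T
    using Cons.IH[OF _ _ _ _ that, of c] Cons.prems p \<open>A = 0\<close> by (auto simp: A_def)
  moreover have "c (insert p T) = 0" if "T \<subseteq> set ps" for T
    using Cons.IH[OF _ _ _ _ that, of "\<lambda>S. c (insert p S)"] Cons.prems p \<open>B = 0\<close>
    by (auto simp: B_def)
  ultimately show ?case
    using Cons.prems(5) by (metis insert_Diff list.simps(15) subset_insert subset_insert_iff)
qed

lemma squarefree_nat_eq_prod_prime_factors:
  fixes d :: nat
  assumes "squarefree d"
  shows "\<Prod>(prime_factors d) = d"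
proof -
  have "d \<noteq> 0" using assms by (auto intro: Nat.gr0I)
  then have "(\<Prod>p\<in>prime_factors d. p ^ multiplicity p d) = d"
    by (simp add: prod_prime_factors)
  moreover have "(\<Prod>p\<in>prime_factors d. p ^ multiplicity p d) = (\<Prod>p\<in>prime_factors d. p)"
    using assms \<open>d \<noteq> 0\<close> by (intro prod.cong) (auto simp: squarefree_factorial_semiring')
  ultimately show ?thesis by simp
qed

lemma sqrt_squarefree_independent:
  fixes D :: "nat set"
  assumes "finite D" "\<And>d. d \<in> D \<Longrightarrow> squarefree d"
    and "(\<Sum>d\<in>D. of_int (u d) * sqrt (real d)) = 0"
    and "d \<in> D"
  shows "u d = 0"
proof -
  define ps where "ps = sorted_list_of_set (\<Union>d\<in>D. prime_factors d)"
  have ps: "set ps = (\<Union>d\<in>D. prime_factors d)" "distinct ps"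
    unfolding ps_def using assms(1) by auto
  \<comment> \<open>A squarefree number corresponds to the set of its prime factors.\<close>
  define c where "c S = (if S \<in> prime_factors ` D then real_of_int (u (\<Prod>S)) else 0)" for S
  have c_prime_factors: "c (prime_factors e) = real_of_int (u e)" if "e \<in> D" for e
    unfolding c_def using imageI[OF that, of prime_factors]
    by (simp only: if_True squarefree_nat_eq_prod_prime_factors[OF assms(2)[OF that]])
  have "(\<Sum>S\<in>Pow (set ps). c S * sqrt (real (\<Prod>S))) =
      (\<Sum>S\<in>prime_factors ` D. c S * sqrt (real (\<Prod>S)))"
  proof (rule sum.mono_neutral_right)
    show "prime_factors ` D \<subseteq> Pow (set ps)" by (auto simp: ps)
  qed (simp_all add: c_def)
  also have "\<dots> = (\<Sum>d\<in>D. c (prime_factors d) * sqrt (real (\<Prod>(prime_factors d))))"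
  proof -
    have "inj_on prime_factors D"
      by (rule inj_on_inverseI[of _ Prod]) (rule squarefree_nat_eq_prod_prime_factors[OF assms(2)])
    then show ?thesis by (rule sum.reindex_cong) (rule refl)+
  qed
  also have "\<dots> = (\<Sum>d\<in>D. of_int (u d) * sqrt (real d))"
    by (intro sum.cong refl) (simp only: c_prime_factors squarefree_nat_eq_prod_prime_factors assms(2))
  also have "\<dots> = 0" by fact
  finally have relation: "(\<Sum>S\<in>Pow (set ps). c S * sqrt (real (\<Prod>S))) = 0" .
  have "c (prime_factors d) = 0"
  proof (rule sqrt_prod_primes_independent[OF ps(2) _ _ relation])
    show "prime p" if "p \<in> set ps" for p
      using that unfolding ps by (blast intro: in_prime_factors_imp_prime)
    show "c S \<in> \<rat>" for S
      by (cases "S \<in> prime_factors ` D") (simp_all only: c_def if_True if_False Rats_of_int Rats_0)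
    show "prime_factors d \<subseteq> set ps"
      using assms(4) unfolding ps by blast
  qed
  then show ?thesis
    using c_prime_factors[OF assms(4)] by simp
qed

lemma kronecker_sqrt_squarefree:
  fixes D :: "nat set" and \<alpha> :: "nat \<Rightarrow> real"
  assumes "finite D" "\<And>d. d \<in> D \<Longrightarrow> squarefree d" "1 \<notin> D" "\<epsilon> > 0"
  obtains m :: int where "\<And>d. d \<in> D \<Longrightarrow> \<exists>k::int. \<bar>of_int m * sqrt (real d) - \<alpha> d - of_int k\<bar> < \<epsilon>"
proof -
  interpret Modules.module "(\<lambda>r. (*) (real_of_int r))"
    by (simp add: Modules.module.intro distrib_left mult.commute)
  obtain ds where ds: "set ds = D" "distinct ds"
    using finite_distinct_list[OF assms(1)] by blast
  \<comment> \<open>Kronecker's theorem for integer multipliers wants the number 1 as the last frequency.\<close>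
  define n where "n = length ds"
  define e where "e i = (ds @ [1]) ! i" for i
  have e_img: "e ` {..n} = insert 1 D"
  proof -
    have "e ` {..n} = set (ds @ [1])"
      unfolding set_conv_nth e_def n_def by (auto simp: less_Suc_eq_le)
    then show ?thesis by (simp add: ds)
  qed
  have e_inj: "inj_on e {..n}"
    unfolding e_def n_def using ds assms(3)
    by (intro inj_on_nth) auto
  have sqrt_inj: "inj_on (\<lambda>d. sqrt (real d)) A" for A
    by (auto simp: inj_on_def)
  define \<theta> where "\<theta> = (\<lambda>i. sqrt (real (e i)))"
  have \<theta>_img: "\<theta> ` {..n} = (\<lambda>d. sqrt (real d)) ` insert 1 D"
    unfolding \<theta>_def e_img[symmetric] by (simp add: image_image)
  have indep: "independent (\<theta> ` {..n})"
    unfolding independent_explicit_module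
  proof (intro allI impI)
    fix t u v
    assume t: "finite t" "t \<subseteq> \<theta> ` {..n}" "(\<Sum>v\<in>t. real_of_int (u v) * v) = 0" "v \<in> t"
    obtain T where T: "T \<subseteq> insert 1 D" "t = (\<lambda>d. sqrt (real d)) ` T"
      using t(2) unfolding \<theta>_img by (rule subset_imageE)
    obtain d where d: "d \<in> T" "v = sqrt (real d)"
      using t(4) T by auto
    have "(\<Sum>d\<in>T. of_int (u (sqrt (real d))) * sqrt (real d)) = 0"
      using t(3) unfolding T by (subst (asm) sum.reindex[OF sqrt_inj]) (simp add: o_def)
    then have "u (sqrt (real d)) = 0"
    proof (rule sqrt_squarefree_independent[rotated 2])
      show "finite T" using T(1) assms(1) by (rule finite_subset[OF _ finite.insertI])
      show "squarefree x" if "x \<in> T" for x using that T(1) assms(2) by auto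
    qed (rule d(1))
    then show "u v = 0" by (simp add: d)
  qed
  have \<theta>_inj: "inj_on \<theta> {..n}"
    using e_inj by (auto simp: \<theta>_def inj_on_def)
  have \<theta>_n: "\<theta> n = 1"
    by (simp add: \<theta>_def e_def n_def)
  obtain k m where km: "\<And>i. i < n \<Longrightarrow> \<bar>of_int k * \<theta> i - of_int (m i) - \<alpha> (e i)\<bar> < \<epsilon>"
    using Kronecker_thm_2[OF indep \<theta>_inj \<theta>_n assms(4), of "\<lambda>i. \<alpha> (e i)"] by blast
  show ?thesis
  proof (rule that)
    fix d assume "d \<in> D"
    then obtain i where i: "i < n" "e i = d"
      using ds unfolding n_def e_def by (metis in_set_conv_nth nth_append)
    show "\<exists>j::int. \<bar>of_int k * sqrt (real d) - \<alpha> d - of_int j\<bar> < \<epsilon>"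
      using km[OF i(1)] i(2) by (intro exI[of _ "m i"]) (simp add: \<theta>_def algebra_simps)
  qed
qed

section \<open>Simultaneous approximation of a half\<close>

lemma square_plus_8_eq_square:
  fixes l b :: int
  assumes "l\<^sup>2 + 8 = b\<^sup>2"
  shows "\<bar>l\<bar> = 1"
proof -
  \<comment> \<open>The factors of \<open>8 = (\<bar>b\<bar> - \<bar>l\<bar>) (\<bar>b\<bar> + \<bar>l\<bar>)\<close> have the same parity, so they are 2 and 4.\<close>
  define j where "j = \<bar>b\<bar> - \<bar>l\<bar>"
  have eq: "j * (2 * \<bar>l\<bar> + j) = 8"
    using assms unfolding j_def by (simp add: algebra_simps flip: power2_eq_square)
  have "j > 0"
  proof (rule ccontr)
    assume "\<not> j > 0"
    then have "j * (2 * \<bar>l\<bar> + j) \<le> 0"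
      unfolding j_def by (intro mult_nonpos_nonneg) auto
    with eq show False by simp
  qed
  moreover have "j < 3"
  proof (rule ccontr)
    assume "\<not> j < 3"
    then have "3 * 3 \<le> j * (2 * \<bar>l\<bar> + j)" by (intro mult_mono) auto
    with eq show False by simp
  qed
  ultimately have "j = 1 \<or> j = 2" by auto
  with eq show ?thesis by (elim disjE) (simp, presburger, simp)
qed

lemma odd_square_mod_8: "odd (x :: nat) \<Longrightarrow> x\<^sup>2 mod 8 = 1"
proof -
  assume "odd x"
  then have "x mod 8 \<in> {1, 3, 5, 7}" by (simp; presburger)
  moreover have "x\<^sup>2 mod 8 = (x mod 8)\<^sup>2 mod 8" by (simp add: power_mod)
  ultimately show ?thesis by auto
qed

text \<open>
  The power of two that divides the square part of \<open>l\<^sup>2 + 8\<close> is determined by the squarefree part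
  alone.
\<close>

lemma squarefree_decomposition_square_plus_8:
  fixes l d b :: nat
  assumes "d * b\<^sup>2 = l\<^sup>2 + 8" "squarefree d"
  shows "if d mod 8 = 1 then odd b else b mod 4 = 2"
proof (cases "odd l")
  case True
  then have "(d * b\<^sup>2) mod 8 = 1"
    using assms(1) odd_square_mod_8[of l] by simp
  then have "odd (d * b\<^sup>2)" by presburger
  then have "odd b" by simp
  have "d mod 8 = (d * (b\<^sup>2 mod 8)) mod 8"
    using odd_square_mod_8[OF \<open>odd b\<close>] by simp
  with \<open>(d * b\<^sup>2) mod 8 = 1\<close> have "d mod 8 = 1"
    by (simp add: mod_mult_right_eq)
  with \<open>odd b\<close> show ?thesis by simp
next
  case False
  then obtain k where l: "l = 2 * k" by auto
  have "even b"
  proof (rule ccontr)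
    assume "odd b"
    then have "coprime (2\<^sup>2) (b\<^sup>2)"
      by (simp only: coprime_power_left_iff coprime_power_right_iff coprime_left_2_iff_odd) simp
    moreover have "2\<^sup>2 dvd d * b\<^sup>2"
      unfolding assms(1) l by (simp add: power2_eq_square)
    ultimately have "2\<^sup>2 dvd d"
      by (simp only: coprime_dvd_mult_left_iff)
    with squarefreeD[OF assms(2), of 2] show False by simp
  qed
  then obtain c where b: "b = 2 * c" by auto
  have eq: "d * c\<^sup>2 = k\<^sup>2 + 2"
    using assms(1) unfolding b l by (simp add: power2_eq_square)
  have k: "k\<^sup>2 mod 8 \<in> {0, 1, 4}"
  proof -
    have "k mod 8 \<in> {0, 1, 2, 3, 4, 5, 6, 7}" by (simp; presburger)
    moreover have "k\<^sup>2 mod 8 = (k mod 8)\<^sup>2 mod 8" by (simp add: power_mod)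
    ultimately show ?thesis by auto
  qed
  have residues: "(x + 2) mod 4 \<noteq> 0 \<and> (x + 2) mod 8 \<noteq> 1" if "x mod 8 \<in> {0, 1, 4}" for x :: nat
  proof -
    have "(x + 2) mod 8 = (x mod 8 + 2) mod 8" by (simp only: mod_add_left_eq)
    with that have "(x + 2) mod 8 \<in> {2, 3, 6}" by auto
    moreover have "(x + 2) mod 4 = (x + 2) mod 8 mod 4" by (simp add: mod_mod_cancel)
    ultimately show ?thesis by auto
  qed
  have "odd c"
  proof
    assume "even c"
    then have "4 dvd d * c\<^sup>2" by (auto simp: power2_eq_square)
    with residues[OF k] show False unfolding eq by (simp add: dvd_eq_mod_eq_0)
  qed
  have "d mod 8 = (d * (c\<^sup>2 mod 8)) mod 8"
    using odd_square_mod_8[OF \<open>odd c\<close>] by simp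
  also have "\<dots> = (k\<^sup>2 + 2) mod 8"
    unfolding eq[symmetric] by (simp add: mod_mult_right_eq)
  finally have "d mod 8 \<noteq> 1" using residues[OF k] by simp
  moreover have "b mod 4 = 2" using \<open>odd c\<close> unfolding b by presburger
  ultimately show ?thesis by simp
qed

lemma sqrt_square_plus_8_approx_half:
  fixes L :: "int set"
  assumes "finite L" "1 \<notin> L" "-1 \<notin> L" "\<epsilon> > 0"
  obtains m :: int where
    "\<And>l. l \<in> L \<Longrightarrow> \<exists>k::int. \<bar>of_int m * sqrt (of_int l ^ 2 + 8) - 1 / 2 - of_int k\<bar> < \<epsilon>"
proof -
  define N where "N l = (nat \<bar>l\<bar>)\<^sup>2 + 8" for l :: int
  define d where "d l = squarefree_part (N l)" for l
  define b where "b l = square_part (N l)" for l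
  have db: "d l * (b l)\<^sup>2 = N l" for l
    unfolding d_def b_def by (rule squarefree_decompose[symmetric])
  have sqf: "squarefree (d l)" for l by (simp add: d_def)
  have sqrt_N: "sqrt (of_int l ^ 2 + 8) = real (b l) * sqrt (real (d l))" for l
  proof -
    have "of_int l ^ 2 + 8 = real (N l)" by (simp add: N_def)
    also have "\<dots> = real (d l) * real (b l) ^ 2" by (simp flip: db)
    finally show ?thesis by (simp add: real_sqrt_mult)
  qed
  \<comment> \<open>Chosen such that \<open>b \<alpha>\<close> is half an odd integer for each decomposition \<open>l\<^sup>2 + 8 = d b\<^sup>2\<close>.\<close>
  define \<alpha> :: "nat \<Rightarrow> real" where "\<alpha> e = (if e mod 8 = 1 then 1 / 2 else 1 / 4)" for e
  have \<alpha>: "\<exists>j::int. real (b l) * \<alpha> (d l) = 1 / 2 + of_int j" for l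
  proof -
    have *: "if d l mod 8 = 1 then odd (b l) else b l mod 4 = 2"
      by (rule squarefree_decomposition_square_plus_8[of _ _ "nat \<bar>l\<bar>"])
        (simp_all add: sqf db N_def)
    show ?thesis
    proof (cases "d l mod 8 = 1")
      case True
      with * obtain j where "b l = 2 * j + 1" by (auto elim: oddE)
      then show ?thesis using True by (intro exI[of _ "int j"]) (simp add: \<alpha>_def field_simps)
    next
      case False
      with * have "b l = 4 * (b l div 4) + 2" by presburger
      then have "real (b l) = 4 * real (b l div 4) + 2" by linarith
      then show ?thesis
        using False by (intro exI[of _ "int (b l div 4)"]) (simp add: \<alpha>_def field_simps)
    qed
  qed
  have "1 \<notin> d ` L"
  proof
    assume "1 \<in> d ` L"
    then obtain l where l: "l \<in> L" "d l = 1" by force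
    then have "N l = (b l)\<^sup>2" using db[of l] by simp
    then have "int (N l) = (int (b l))\<^sup>2" by simp
    then have "l\<^sup>2 + 8 = (int (b l))\<^sup>2" by (simp add: N_def)
    then have "\<bar>l\<bar> = 1" by (rule square_plus_8_eq_square)
    with l assms show False by (auto simp: abs_if split: if_splits)
  qed
  \<comment> \<open>Multiplying by \<open>b\<close> magnifies the approximation error, by a factor less than \<open>B\<close>.\<close>
  define B where "B = (\<Sum>l\<in>L. real (b l)) + 1"
  have B: "real (b l) < B" if "l \<in> L" for l
    using member_le_sum[of l L "\<lambda>l. real (b l)"] that assms(1) by (simp add: B_def)
  have "B > 0" unfolding B_def by (intro add_nonneg_pos sum_nonneg) auto
  obtain m :: int where m:
    "\<And>e. e \<in> d ` L \<Longrightarrow> \<exists>k::int. \<bar>of_int m * sqrt (real e) - \<alpha> e - of_int k\<bar> < \<epsilon> / B"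
    using kronecker_sqrt_squarefree[of "d ` L" "\<epsilon> / B" \<alpha>] assms sqf \<open>1 \<notin> d ` L\<close> \<open>B > 0\<close>
    by auto
  show ?thesis
  proof (rule that)
    fix l assume l: "l \<in> L"
    then obtain k :: int where k: "\<bar>of_int m * sqrt (real (d l)) - \<alpha> (d l) - of_int k\<bar> < \<epsilon> / B"
      using m by blast
    obtain j :: int where j: "real (b l) * \<alpha> (d l) = 1 / 2 + of_int j"
      using \<alpha> by blast
    let ?x = "of_int m * sqrt (real (d l)) - \<alpha> (d l) - of_int k"
    have "of_int m * sqrt (of_int l ^ 2 + 8) - 1 / 2 - of_int (j + int (b l) * k) = real (b l) * ?x"
      unfolding sqrt_N using j by (simp add: algebra_simps)
    also have "\<bar>\<dots>\<bar> \<le> B * \<bar>?x\<bar>"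
      unfolding abs_mult using B[OF l] by (intro mult_right_mono) auto
    also have "\<dots> < \<epsilon>"
      using k \<open>B > 0\<close> by (simp add: field_simps)
    finally show "\<exists>k::int. \<bar>of_int m * sqrt (of_int l ^ 2 + 8) - 1 / 2 - of_int k\<bar> < \<epsilon>" by blast
  qed
qed

section \<open>Eigenvectors and state transfer\<close>

text \<open>
  The equation \<open>M x = \<mu> x\<close> on the index set \<open>V\<close>. The zero vector is admitted, as are arbitrary
  values outside \<open>V\<close>.
\<close>

definition eigenvector :: "'a set \<Rightarrow> ('a \<Rightarrow> 'a \<Rightarrow> complex) \<Rightarrow> complex \<Rightarrow> ('a \<Rightarrow> complex) \<Rightarrow> bool" where
  "eigenvector V M \<mu> x \<longleftrightarrow> (\<forall>u\<in>V. mvec V M x u = \<mu> * x u)"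

lemma eigenvectorD: "eigenvector V M \<mu> x \<Longrightarrow> u \<in> V \<Longrightarrow> mvec V M x u = \<mu> * x u"
  by (simp add: eigenvector_def)

lemma mvec_cong: "(\<And>v. v \<in> V \<Longrightarrow> x v = y v) \<Longrightarrow> mvec V M x u = mvec V M y u"
  by (simp add: mvec_def)

lemma mvec_scale: "mvec V M (\<lambda>v. c * x v) u = c * mvec V M x u"
  by (simp add: mvec_def sum_distrib_left algebra_simps)

lemma mvec_sum: "mvec V M (\<lambda>v. \<Sum>j\<in>J. w j v) u = (\<Sum>j\<in>J. mvec V M (w j) u)"
  unfolding mvec_def sum_distrib_left by (rule sum.swap)

lemma mvec_mmul: "mvec V (mmul V M N) x u = mvec V M (mvec V N x) u"
  unfolding mvec_def mmul_def sum_distrib_left sum_distrib_right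
  by (subst sum.swap) (simp add: mult.assoc)

lemma eigenvector_scale: "eigenvector V M \<mu> x \<Longrightarrow> eigenvector V M \<mu> (\<lambda>v. c * x v)"
  by (simp add: eigenvector_def mvec_scale)

lemma eigenvector_scale_matrix:
  "eigenvector V M \<mu> x \<Longrightarrow> eigenvector V (\<lambda>u v. c * M u v) (c * \<mu>) x"
  by (simp add: eigenvector_def mvec_def mult.assoc flip: sum_distrib_left)

lemma mvec_mpow_eigenvector:
  assumes "finite V" "eigenvector V M \<mu> x" "u \<in> V"
  shows "mvec V (mpow V M k) x u = \<mu> ^ k * x u"
  using assms(3)
proof (induction k arbitrary: u)
  case 0
  then show ?case using assms(1) by (simp add: mvec_def)
next
  case (Suc k)
  have "mvec V (mpow V M (Suc k)) x u = mvec V M (mvec V (mpow V M k) x) u"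
    by (simp add: mvec_mmul)
  also have "\<dots> = mvec V M (\<lambda>v. \<mu> ^ k * x v) u"
    by (intro mvec_cong Suc.IH)
  also have "\<dots> = \<mu> ^ k * (\<mu> * x u)"
    using assms(2) Suc.prems by (simp add: mvec_scale eigenvectorD)
  finally show ?case by simp
qed

lemma mvec_mexp_eigenvector:
  assumes "finite V" "eigenvector V M \<mu> x" "u \<in> V"
  shows "mvec V (mexp V M) x u = exp \<mu> * x u"
proof -
  have "(\<lambda>k. \<Sum>v\<in>V. mpow V M k u v / fact k * x v) sums (\<Sum>v\<in>V. mexp V M u v * x v)"
    unfolding mexp_def using assms(1,3)
    by (intro sums_sum sums_mult2 summable_sums summable_norm_cancel[OF summable_mexp]) auto
  also have "(\<lambda>k. \<Sum>v\<in>V. mpow V M k u v / fact k * x v) = (\<lambda>k. \<mu> ^ k / fact k * x u)"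
  proof
    fix k
    have "(\<Sum>v\<in>V. mpow V M k u v / fact k * x v) = mvec V (mpow V M k) x u / fact k"
      by (simp add: mvec_def sum_divide_distrib)
    then show "(\<Sum>v\<in>V. mpow V M k u v / fact k * x v) = \<mu> ^ k / fact k * x u"
      using mvec_mpow_eigenvector[OF assms] by simp
  qed
  finally have "(\<lambda>k. \<mu> ^ k / fact k * x u) sums mvec V (mexp V M) x u"
    by (simp add: mvec_def)
  moreover have "(\<lambda>k. \<mu> ^ k / fact k * x u) sums (exp \<mu> * x u)"
    using sums_mult2[OF exp_converges[of \<mu>], of "x u"] by (simp add: scaleR_conv_of_real field_simps)
  ultimately show ?thesis by (rule sums_unique2)
qed

text \<open>
  A criterion for pretty good state transfer: the unit vector at \<open>a\<close> is a sum of eigenvectors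
  \<open>w j\<close>, the unit vector at \<open>b\<close> times a phase \<open>\<gamma>\<close> is the same sum with coefficients \<open>\<sigma> j\<close>, and these
  coefficients are simultaneously approximated by the phases that the evolution gives to the \<open>w j\<close>.
\<close>

lemma pretty_good_state_transferI:
  fixes \<theta> :: "'j \<Rightarrow> real" and \<sigma> :: "'j \<Rightarrow> complex"
  assumes fin: "finite (pverts X)" "finite J"
    and ab: "a \<in> pverts X" "b \<in> pverts X"
    and eig: "\<And>j. j \<in> J \<Longrightarrow> eigenvector (pverts X) (adj_matrix X) (of_real (\<theta> j)) (w j)"
    and a: "\<And>u. u \<in> pverts X \<Longrightarrow> unit_vec a u = (\<Sum>j\<in>J. w j u)"
    and b: "\<And>u. u \<in> pverts X \<Longrightarrow> \<gamma> * unit_vec b u = (\<Sum>j\<in>J. \<sigma> j * w j u)"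
    and \<gamma>: "cmod \<gamma> = 1"
    and approx: "\<And>\<epsilon>. \<epsilon> > 0 \<Longrightarrow> \<exists>\<tau>. \<forall>j\<in>J. cmod (exp (- \<i> * of_real \<tau> * of_real (\<theta> j)) - \<sigma> j) < \<epsilon>"
  shows "pretty_good_state_transfer X a b"
  unfolding pretty_good_state_transfer_def
proof (intro conjI allI impI ab)
  fix \<epsilon> :: real assume "\<epsilon> > 0"
  let ?V = "pverts X"
  define C where "C = (\<Sum>u\<in>?V. \<Sum>j\<in>J. cmod (w j u)) + 1"
  have "C > 0" unfolding C_def by (intro add_nonneg_pos sum_nonneg) auto
  with \<open>\<epsilon> > 0\<close> obtain \<tau> where \<tau>:
    "\<And>j. j \<in> J \<Longrightarrow> cmod (exp (- \<i> * of_real \<tau> * of_real (\<theta> j)) - \<sigma> j) < \<epsilon> / C"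
    using approx[of "\<epsilon> / C"] by auto
  let ?E = "\<lambda>j. exp (- \<i> * of_real \<tau> * of_real (\<theta> j)) - \<sigma> j"
  let ?D = "\<lambda>u. mvec ?V (transition_matrix X \<tau>) (unit_vec a) u - \<gamma> * unit_vec b u"
  have D: "?D u = (\<Sum>j\<in>J. ?E j * w j u)" if u: "u \<in> ?V" for u
  proof -
    have "mvec ?V (transition_matrix X \<tau>) (unit_vec a) u =
        (\<Sum>j\<in>J. mvec ?V (transition_matrix X \<tau>) (w j) u)"
      unfolding mvec_sum[symmetric] by (intro mvec_cong a)
    also have "\<dots> = (\<Sum>j\<in>J. exp (- \<i> * of_real \<tau> * of_real (\<theta> j)) * w j u)"
      unfolding transition_matrix_def
      by (intro sum.cong refl mvec_mexp_eigenvector eigenvector_scale_matrix eig fin u)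
    finally show ?thesis
      by (simp add: b[OF u] sum_subtractf algebra_simps)
  qed
  have "vnorm ?V ?D \<le> (\<Sum>u\<in>?V. cmod (?D u))"
    unfolding vnorm_def by (intro L2_set_le_sum) auto
  also have "\<dots> \<le> (\<Sum>u\<in>?V. \<Sum>j\<in>J. \<epsilon> / C * cmod (w j u))"
  proof (intro sum_mono)
    fix u assume "u \<in> ?V"
    then have "cmod (?D u) = cmod (\<Sum>j\<in>J. ?E j * w j u)" by (simp only: D)
    also have "\<dots> \<le> (\<Sum>j\<in>J. \<epsilon> / C * cmod (w j u))"
      using \<tau> by (intro sum_norm_le) (simp only: norm_mult, intro mult_right_mono less_imp_le norm_ge_zero)
    finally show "cmod (?D u) \<le> (\<Sum>j\<in>J. \<epsilon> / C * cmod (w j u))" .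
  qed
  also have "\<dots> = \<epsilon> / C * (C - 1)"
    by (simp add: C_def sum_distrib_left)
  also have "\<dots> < \<epsilon>"
    using \<open>C > 0\<close> \<open>\<epsilon> > 0\<close> by (simp add: field_simps)
  finally show "\<exists>\<tau> \<gamma>. cmod \<gamma> = 1 \<and>
      vnorm ?V (\<lambda>u. mvec ?V (transition_matrix X \<tau>) (unit_vec a) u - \<gamma> * unit_vec b u) < \<epsilon>"
    using \<gamma> by blast
qed

section \<open>Coronas with two isolated vertices\<close>

lemma pverts_corona_edgeless_2:
  "pverts (corona G (edgeless_graph 2)) = pverts G \<times> {None, Some 1, Some 2}"
  by (auto simp: corona_def edgeless_graph_def)

lemma mvec_corona_edgeless_2:
  assumes "finite (pverts G)" "u \<in> pverts G"
  defines "X \<equiv> corona G (edgeless_graph 2)"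
  shows "mvec (pverts X) (adj_matrix X) z (u, None) =
      mvec (pverts G) (adj_matrix G) (\<lambda>v. z (v, None)) u + z (u, Some 1) + z (u, Some 2)"
    and "k \<in> {1, 2} \<Longrightarrow> mvec (pverts X) (adj_matrix X) z (u, Some k) = z (u, None)"
proof -
  have sum: "(\<Sum>p\<in>pverts X. f p) =
      (\<Sum>v\<in>pverts G. f (v, None) + f (v, Some 1) + f (v, Some 2))" for f :: "_ \<Rightarrow> complex"
    unfolding X_def pverts_corona_edgeless_2
    by (simp add: sum.cartesian_product' add.assoc)
  have adj:
    "adj_matrix X (u, None) (v, None) = adj_matrix G u v"
    "adj_matrix X (u, None) (v, Some 1) = of_bool (u = v)"
    "adj_matrix X (u, None) (v, Some 2) = of_bool (u = v)"
    "k \<in> {1, 2} \<Longrightarrow> adj_matrix X (u, Some k) (v, None) = of_bool (u = v)"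
    "adj_matrix X (u, Some k) (v, Some i) = 0"
    if "v \<in> pverts G" for v k i
    using that assms(2) by (auto simp: adj_matrix_def X_def corona_def edgeless_graph_def)
  show "mvec (pverts X) (adj_matrix X) z (u, None) =
      mvec (pverts G) (adj_matrix G) (\<lambda>v. z (v, None)) u + z (u, Some 1) + z (u, Some 2)"
    unfolding mvec_def sum using assms(1,2) by (simp add: adj sum.distrib del: One_nat_def)
  show "mvec (pverts X) (adj_matrix X) z (u, Some k) = z (u, None)" if "k \<in> {1, 2}"
    unfolding mvec_def sum using assms(1,2) that by (simp add: adj sum.distrib del: One_nat_def cong: sum.cong)
qed

text \<open>
  Two copies of an eigenvector on the leaves, and a multiple of it on the base graph.
\<close>

lemma eigenvector_corona_symmetric:
  assumes "finite (pverts G)" "eigenvector (pverts G) (adj_matrix G) l y" "\<mu>\<^sup>2 = l * \<mu> + 2"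
  defines "X \<equiv> corona G (edgeless_graph 2)"
  shows "eigenvector (pverts X) (adj_matrix X) \<mu> (\<lambda>(u, w). (if w = None then \<mu> else 1) * y u)"
    (is "eigenvector _ _ _ ?z")
  unfolding eigenvector_def
proof
  fix p assume "p \<in> pverts X"
  then obtain u w where p: "p = (u, w)" "u \<in> pverts G" "w \<in> {None, Some 1, Some 2}"
    by (auto simp: X_def pverts_corona_edgeless_2)
  note mvec_X = mvec_corona_edgeless_2[OF assms(1) p(2), folded X_def]
  show "mvec (pverts X) (adj_matrix X) ?z p = \<mu> * ?z p"
  proof (cases w)
    case None
    have "mvec (pverts X) (adj_matrix X) ?z p = \<mu> * (l * y u) + y u + y u"
      unfolding p None mvec_X using eigenvectorD[OF assms(2) p(2)] by (simp add: mvec_scale)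
    also have "\<dots> = (l * \<mu> + 2) * y u"
      by (simp add: algebra_simps)
    also have "\<dots> = \<mu> * ?z p"
      unfolding p None by (simp flip: assms(3) add: power2_eq_square)
    finally show ?thesis .
  next
    case (Some k)
    then have "k \<in> {1, 2}" using p(3) by auto
    then show ?thesis
      unfolding p Some by (subst mvec_X(2)) simp_all
  qed
qed

text \<open>
  Opposite values on the two leaves of each base vertex cancel at that vertex.
\<close>

lemma eigenvector_corona_antisymmetric:
  assumes "finite (pverts G)"
  defines "X \<equiv> corona G (edgeless_graph 2)"
  shows "eigenvector (pverts X) (adj_matrix X) 0
    (\<lambda>(u, w). (if w = None then 0 else if w = Some 1 then 1 else - 1) * y u)"
    (is "eigenvector _ _ _ ?z")
  unfolding eigenvector_def
proof
  fix p assume "p \<in> pverts X"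
  then obtain u w where p: "p = (u, w)" "u \<in> pverts G" "w \<in> {None, Some 1, Some 2}"
    by (auto simp: X_def pverts_corona_edgeless_2)
  note mvec_X = mvec_corona_edgeless_2[OF assms(1) p(2), folded X_def]
  show "mvec (pverts X) (adj_matrix X) ?z p = 0 * ?z p"
  proof (cases w)
    case None
    then show ?thesis
      unfolding p None mvec_X by (simp add: mvec_def)
  next
    case (Some k)
    then have "k \<in> {1, 2}" using p(3) by auto
    then show ?thesis
      unfolding p Some by (subst mvec_X(2)) simp_all
  qed
qed

lemma norm_exp_near_minus_1:
  assumes "t = \<delta> + pi + 2 * pi * of_int q"
  shows "cmod (exp (\<i> * of_real t) - (- 1)) \<le> \<bar>\<delta>\<bar>"
proof -
  have "exp (\<i> * of_real t) = cis t"
    by (simp add: cis_conv_exp)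
  also have "\<dots> = cis \<delta> * cis pi * cis (2 * pi * of_int q)"
    by (simp only: assms cis_mult)
  also have "cis (2 * pi * of_int q) = 1"
    by (rule cis_multiple_2pi) simp
  finally have "exp (\<i> * of_real t) - (- 1) = - (exp (\<i> * of_real \<delta>) - 1)"
    by (simp add: cis_conv_exp)
  then have "cmod (exp (\<i> * of_real t) - (- 1)) = 2 * \<bar>sin (\<delta> / 2)\<bar>"
    by (simp only: norm_minus_cancel dist_exp_i_1)
  also have "\<dots> \<le> \<bar>\<delta>\<bar>"
    using abs_sin_x_le_abs_x[of "\<delta> / 2"] by simp
  finally show ?thesis .
qed

text \<open>
  Integrality of the whole spectrum is not needed: only the eigenvalues in some decomposition of the
  unit vector at \<open>v\<close> into eigenvectors have to be integers other than \<open>1\<close> and \<open>- 1\<close>. They need not be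
  distinct.
\<close>

theorem pretty_good_state_transfer_corona_edgeless_2:
  fixes G :: "'a pair_pre_digraph" and l :: "'j \<Rightarrow> int"
  assumes G: "finite (pverts G)" "v \<in> pverts G"
    and J: "finite J"
    and eig: "\<And>j. j \<in> J \<Longrightarrow> eigenvector (pverts G) (adj_matrix G) (of_int (l j)) (y j)"
    and decomp: "\<And>u. u \<in> pverts G \<Longrightarrow> unit_vec v u = (\<Sum>j\<in>J. y j u)"
    and l: "\<And>j. j \<in> J \<Longrightarrow> l j \<noteq> 1 \<and> l j \<noteq> - 1"
  shows "pretty_good_state_transfer (corona G (edgeless_graph 2)) (v, Some 1) (v, Some 2)"
proof -
  define X where "X = corona G (edgeless_graph 2)"
  define r where "r j = sqrt (of_int (l j) ^ 2 + 8)" for j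
  define \<mu> where "\<mu> j s = (of_int (l j) + of_int s * r j) / 2" for j and s :: int
  \<comment> \<open>The weights of the two eigenvectors over \<open>y j\<close> that cancel on the base graph and give \<open>y j / 2\<close>
    on both leaves.\<close>
  define c where "c j s = (r j - of_int s * of_int (l j)) / (4 * r j)" for j and s :: int
  have r: "r j > 0" "r j * r j = of_int (l j) ^ 2 + 8" for j
    unfolding r_def by (auto intro: add_nonneg_pos)
  have \<mu>: "\<mu> j s ^ 2 = of_int (l j) * \<mu> j s + 2" if "s \<in> {1, - 1}" for j s
    using that r(2)[of j] by (auto simp: \<mu>_def power2_eq_square field_simps)
  have c_sum: "c j 1 + c j (- 1) = 1 / 2" for j
    using r(1)[of j] by (simp add: c_def field_simps)
  have c\<mu>_sum: "c j 1 * \<mu> j 1 + c j (- 1) * \<mu> j (- 1) = 0" for j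
    using r(1)[of j] by (simp add: c_def \<mu>_def field_simps)

  \<comment> \<open>The index \<open>None\<close> stands for the antisymmetric vector, and \<open>Some (j, s)\<close> for the symmetric one
    over \<open>y j\<close> whose eigenvalue has the sign \<open>s\<close> in front of the root.\<close>
  define K where "K = insert None (Some ` (J \<times> {1, - 1 :: int}))"
  define \<theta> where "\<theta> k = (case k of None \<Rightarrow> 0 | Some (j, s) \<Rightarrow> \<mu> j s)" for k
  define \<sigma> :: "('j \<times> int) option \<Rightarrow> complex" where "\<sigma> k = (if k = None then 1 else - 1)" for k
  define anti :: "'a \<times> nat option \<Rightarrow> complex" where
    "anti = (\<lambda>(u, w). (if w = None then 0 else if w = Some 1 then 1 else - 1) * (unit_vec v u / 2))"
  define sym :: "'j \<Rightarrow> int \<Rightarrow> 'a \<times> nat option \<Rightarrow> complex" where "sym j s =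
    (\<lambda>p. of_real (c j s) * (\<lambda>(u, w). (if w = None then of_real (\<mu> j s) else 1) * y j u) p)" for j s
  define w where "w k = (case k of None \<Rightarrow> anti | Some (j, s) \<Rightarrow> sym j s)" for k

  have sum_K: "(\<Sum>k\<in>K. f k) = f None + (\<Sum>j\<in>J. f (Some (j, 1)) + f (Some (j, - 1)))"
    for f :: "_ \<Rightarrow> complex"
    unfolding K_def using J
    by (simp add: sum.reindex sum.cartesian_product' o_def)
  have sum_sym: "(\<Sum>j\<in>J. sym j 1 (u, k) + sym j (- 1) (u, k)) =
      (if k = None then 0 else unit_vec v u / 2)" if "u \<in> pverts G" for u k
  proof (cases "k = None")
    case True
    have "sym j 1 (u, k) + sym j (- 1) (u, k) =
        of_real (c j 1 * \<mu> j 1 + c j (- 1) * \<mu> j (- 1)) * y j u" for j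
      by (simp add: sym_def True algebra_simps)
    then show ?thesis by (simp only: c\<mu>_sum) (simp add: True)
  next
    case False
    have "sym j 1 (u, k) + sym j (- 1) (u, k) = of_real (c j 1 + c j (- 1)) * y j u" for j
      by (simp only: sym_def False if_False prod.case) (simp add: algebra_simps)
    then show ?thesis
      using False by (simp only: c_sum) (simp add: decomp[OF that] sum_divide_distrib)
  qed

  show ?thesis
    unfolding X_def[symmetric]
  proof (rule pretty_good_state_transferI[where \<theta> = \<theta> and \<sigma> = \<sigma> and w = w and J = K and \<gamma> = "- 1"])
    show "finite (pverts X)"
      using G by (simp add: X_def pverts_corona_edgeless_2)
    show "finite K" using J by (simp add: K_def)
    show "(v, Some 1) \<in> pverts X" "(v, Some 2) \<in> pverts X"
      using G by (auto simp: X_def pverts_corona_edgeless_2)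
    show "cmod (- 1) = 1" by simp
    show "eigenvector (pverts X) (adj_matrix X) (of_real (\<theta> k)) (w k)" if k: "k \<in> K" for k
    proof (cases k)
      case None
      then show ?thesis
        using eigenvector_corona_antisymmetric[OF G(1), of "\<lambda>u. unit_vec v u / 2"]
        by (simp only: None w_def \<theta>_def anti_def X_def option.case of_real_0)
    next
      case (Some js)
      then obtain j s where js: "k = Some (j, s)" "j \<in> J" "s \<in> {1, - 1}"
        using k by (auto simp: K_def)
      have "complex_of_real (\<mu> j s) ^ 2 = of_int (l j) * of_real (\<mu> j s) + 2"
        using arg_cong[OF \<mu>[OF js(3)], of complex_of_real] by simp
      from eigenvector_scale[OF eigenvector_corona_symmetric[OF G(1) eig[OF js(2)] this]]
      show ?thesis
        by (simp add: js(1) w_def \<theta>_def sym_def X_def)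
    qed
    show "unit_vec (v, Some 1) p = (\<Sum>k\<in>K. w k p)"
      and "- 1 * unit_vec (v, Some 2) p = (\<Sum>k\<in>K. \<sigma> k * w k p)"
      if p_in: "p \<in> pverts X" for p
    proof -
      obtain u k where p: "p = (u, k)" "u \<in> pverts G" "k \<in> {None, Some 1, Some 2}"
        using p_in unfolding X_def pverts_corona_edgeless_2 by (elim SigmaE)
      have "(\<Sum>k\<in>K. w k p) = anti p + (\<Sum>j\<in>J. sym j 1 p + sym j (- 1) p)"
        by (simp add: sum_K w_def)
      then show "unit_vec (v, Some 1) p = (\<Sum>k\<in>K. w k p)"
        using p(3) unfolding p(1) sum_sym[OF p(2)] by (auto simp: anti_def unit_vec_def)
      have "(\<Sum>k\<in>K. \<sigma> k * w k p) = anti p - (\<Sum>j\<in>J. sym j 1 p + sym j (- 1) p)"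
        by (simp add: sum_K w_def \<sigma>_def sum_negf[symmetric] del: sum_negf)
      then show "- 1 * unit_vec (v, Some 2) p = (\<Sum>k\<in>K. \<sigma> k * w k p)"
        using p(3) unfolding p(1) sum_sym[OF p(2)] by (auto simp: anti_def unit_vec_def)
    qed
    show "\<exists>\<tau>. \<forall>k\<in>K. cmod (exp (- \<i> * of_real \<tau> * of_real (\<theta> k)) - \<sigma> k) < \<epsilon>"
      if "\<epsilon> > 0" for \<epsilon>
    proof -
      have "finite (l ` J)" "1 \<notin> l ` J" "- 1 \<notin> l ` J" "\<epsilon> / (2 * pi) > 0"
        using J l that by (simp_all add: image_iff) metis+
      then obtain m :: int where
        "\<And>a. a \<in> l ` J \<Longrightarrow> \<exists>q::int. \<bar>of_int m * sqrt (of_int a ^ 2 + 8) - 1 / 2 - of_int q\<bar> < \<epsilon> / (2 * pi)"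
        by (rule sqrt_square_plus_8_approx_half) blast
      then have m: "\<exists>q::int. \<bar>of_int m * r j - 1 / 2 - of_int q\<bar> < \<epsilon> / (2 * pi)" if "j \<in> J" for j
        unfolding r_def using that by blast
      have "cmod (exp (- \<i> * of_real (4 * pi * of_int m) * of_real (\<theta> k)) - \<sigma> k) < \<epsilon>"
        if k: "k \<in> K" for k
      proof (cases k)
        case None
        then show ?thesis using \<open>\<epsilon> > 0\<close> by (simp add: \<theta>_def \<sigma>_def)
      next
        case (Some js)
        then obtain j s where js: "k = Some (j, s)" "j \<in> J" "s \<in> {1, - 1}"
          using k by (auto simp: K_def)
        obtain q :: int where q: "\<bar>of_int m * r j - 1 / 2 - of_int q\<bar> < \<epsilon> / (2 * pi)"
          using m[OF js(2)] by blast
        define x where "x = of_int m * r j - 1 / 2 - of_int q"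
        define t where "t = - (4 * pi * of_int m * \<mu> j s)"
        have mr: "of_int m * r j = x + 1 / 2 + of_int q" by (simp add: x_def)
        \<comment> \<open>The first summand is a multiple of \<open>2 \<pi>\<close>, the second an odd multiple of \<open>\<pi>\<close> up to \<open>2 \<pi> x\<close>.\<close>
        have t: "t = - 2 * pi * of_int (m * l j) - 2 * pi * of_int s * (of_int m * r j)"
          by (simp add: t_def \<mu>_def algebra_simps)
        have "\<exists>q'. t = - 2 * pi * of_int s * x + pi + 2 * pi * of_int q'"
        proof (cases "s = 1")
          case True
          then show ?thesis
            unfolding t mr by (intro exI[of _ "- m * l j - q - 1"]) (simp add: algebra_simps)
        next
          case False
          with js(3) have "s = - 1" by simp
          then show ?thesis
            unfolding t mr by (intro exI[of _ "- m * l j + q"]) (simp add: algebra_simps)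
        qed
        then have "cmod (exp (\<i> * of_real t) - (- 1)) \<le> \<bar>- 2 * pi * of_int s * x\<bar>"
          using norm_exp_near_minus_1 by blast
        also have "\<dots> = 2 * pi * \<bar>x\<bar>"
          using js(3) by (auto simp: abs_mult)
        also have "\<dots> < \<epsilon>"
          using q by (simp add: x_def field_simps)
        also have "exp (\<i> * of_real t) - (- 1) =
            exp (- \<i> * of_real (4 * pi * of_int m) * of_real (\<theta> k)) - \<sigma> k"
          by (simp add: js(1) \<theta>_def \<sigma>_def t_def mult.assoc)
        finally show ?thesis .
      qed
      then show ?thesis by blast
    qed
  qed
qed

section \<open>Cartesian products of complete graphs\<close>

lemma eigenvector_cartesian_product:
  assumes "pair_graph G" "pair_graph H"
    and "eigenvector (pverts G) (adj_matrix G) \<alpha> x" "eigenvector (pverts H) (adj_matrix H) \<beta> y"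
  shows "eigenvector (pverts (G \<box> H)) (adj_matrix (G \<box> H)) (\<alpha> + \<beta>) (\<lambda>(u, v). x u * y v)"
  unfolding eigenvector_def
proof
  interpret G: pair_graph G by fact
  interpret H: pair_graph H by fact
  fix p assume "p \<in> pverts (G \<box> H)"
  then obtain u v where p: "p = (u, v)" "u \<in> pverts G" "v \<in> pverts H"
    by (auto simp: cartesian_product_def)
  have "mvec (pverts (G \<box> H)) (adj_matrix (G \<box> H)) (\<lambda>(u, v). x u * y v) p =
      (\<Sum>u'\<in>pverts G. \<Sum>v'\<in>pverts H. adj_matrix (G \<box> H) (u, v) (u', v') * (x u' * y v'))"
    by (simp add: mvec_def p(1) cartesian_product_def sum.cartesian_product')
  also have "\<dots> = (\<Sum>u'\<in>pverts G. \<Sum>v'\<in>pverts H.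
      (adj_matrix G u u' * x u') * (of_bool (v = v') * y v') +
      (of_bool (u = u') * x u') * (adj_matrix H v v' * y v'))"
    using p assms(1,2)
    by (intro sum.cong refl) (simp add: adj_matrix_cartesian_product algebra_simps)
  also have "\<dots> = mvec (pverts G) (adj_matrix G) x u * y v + x u * mvec (pverts H) (adj_matrix H) y v"
    using p G.pair_finite_verts H.pair_finite_verts
    by (simp add: mvec_def sum.distrib flip: sum_distrib_left sum_distrib_right)
  also have "\<dots> = (\<alpha> + \<beta>) * (x u * y v)"
    using p assms(3,4) by (simp add: eigenvectorD algebra_simps)
  finally show "mvec (pverts (G \<box> H)) (adj_matrix (G \<box> H)) (\<lambda>(u, v). x u * y v) p =
      (\<alpha> + \<beta>) * (case p of (u, v) \<Rightarrow> x u * y v)"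
    by (simp add: p(1))
qed

lemma mvec_complete_graph:
  assumes "i \<in> {1..n}"
  shows "mvec {1..n} (adj_matrix (complete_graph n)) x i = (\<Sum>k\<in>{1..n}. x k) - x i"
proof -
  have "mvec {1..n} (adj_matrix (complete_graph n)) x i = (\<Sum>k\<in>{1..n}. x k - of_bool (i = k) * x k)"
    unfolding mvec_def using assms
    by (intro sum.cong refl) (auto simp: adj_matrix_def complete_graph_def)
  then show ?thesis using assms by (simp add: sum_subtractf)
qed

text \<open>
  The unit vector at \<open>i\<close>, projected onto the constant vectors for \<^verbatim>\<open>True\<close> and onto the vectors with
  entry sum zero for \<^verbatim>\<open>False\<close>. These are the eigenspaces of the complete graph on \<open>{1..n}\<close>.
\<close>

definition complete_proj :: "nat \<Rightarrow> bool \<Rightarrow> nat \<Rightarrow> nat \<Rightarrow> complex" where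
  "complete_proj n t i k = (if t then 1 / of_nat n else unit_vec i k - 1 / of_nat n)"

text \<open>
  The eigenvalues of the complete graph on \<open>{1..n}\<close> that belong to these two eigenspaces.
\<close>

definition complete_eigenvalue :: "nat \<Rightarrow> bool \<Rightarrow> int" where
  "complete_eigenvalue n t = (if t then int n - 1 else - 1)"

lemma eigenvector_complete_graph:
  assumes "i \<in> {1..n}"
  shows "eigenvector (pverts (complete_graph n)) (adj_matrix (complete_graph n))
    (of_int (complete_eigenvalue n t)) (complete_proj n t i)"
proof -
  have "n > 0" using assms by auto
  then have sum: "(\<Sum>k\<in>{1..n}. complete_proj n t i k) = (if t then 1 else 0)"
    using assms by (simp add: complete_proj_def unit_vec_def sum_subtractf)
  have "mvec {1..n} (adj_matrix (complete_graph n)) (complete_proj n t i) k =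
      of_int (complete_eigenvalue n t) * complete_proj n t i k" if "k \<in> {1..n}" for k
    unfolding mvec_complete_graph[OF that] sum using \<open>n > 0\<close>
    by (simp add: complete_proj_def complete_eigenvalue_def field_simps)
  then show ?thesis
    by (simp add: eigenvector_def complete_graph_def)
qed

theorem theorem5p4:
  fixes n :: nat
  assumes "n > 0" and "n \<noteq> 1" and "n \<noteq> 3"
  shows "\<forall>v \<in> pverts (complete_graph n \<box> complete_graph 2).
    pretty_good_state_transfer
      (corona (complete_graph n \<box> complete_graph 2) (edgeless_graph 2))
      (v, Some 1) (v, Some 2)"
proof
  let ?G = "complete_graph n \<box> complete_graph 2"
  fix v assume v: "v \<in> pverts ?G"
  then obtain i a where ia: "v = (i, a)" "i \<in> {1..n}" "a \<in> {1..2}"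
    by (auto simp: cartesian_product_def complete_graph_def)
  define y where "y = (\<lambda>(s, t) (u, x). complete_proj n s i u * complete_proj 2 t a x)"
  define l where "l = (\<lambda>(s, t). complete_eigenvalue n s + complete_eigenvalue 2 t)"
  show "pretty_good_state_transfer (corona ?G (edgeless_graph 2)) (v, Some 1) (v, Some 2)"
  proof (rule pretty_good_state_transfer_corona_edgeless_2[where J = UNIV and l = l and y = y])
    show "finite (pverts ?G)" by (simp add: cartesian_product_def complete_graph_def)
    show "eigenvector (pverts ?G) (adj_matrix ?G) (of_int (l j)) (y j)" for j
      using eigenvector_cartesian_product[OF pair_graph_complete_graph pair_graph_complete_graph
          eigenvector_complete_graph[OF ia(2)] eigenvector_complete_graph[OF ia(3)]]
      by (cases j) (simp add: y_def l_def)
    show "unit_vec v u = (\<Sum>j\<in>UNIV. y j u)" for u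
      by (cases u)
        (auto simp: y_def ia(1) complete_proj_def unit_vec_def UNIV_bool sum.cartesian_product'
          simp flip: UNIV_Times_UNIV)
    show "l j \<noteq> 1 \<and> l j \<noteq> - 1" for j
      using assms by (cases j) (auto simp: l_def complete_eigenvalue_def)
  qed (use v in simp_all)
qed

end
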